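(* Let $\gamma>0$, $C>0$ and $\mathbf{s}=(s_1,\dots,s_m)^\top\in\mathbb{R}^m$. Then $$\mathrm{prox}_{\gamma C L_r}(\mathbf{s})=\mathrm{prox}_{\gamma C\ell_r}(s_1)\times\cdots\times\mathrm{prox}_{\gamma C\ell_r}(s_m),$$ that is, $\mathbf{v}\in\mathrm{prox}_{\gamma C L_r}(\mathbf{s})$ if and only if $v_i\in\mathrm{prox}_{\gamma C\ell_r}(s_i)$ for all $i=1,\dots,m$, where for each $s\in\mathbb{R}$ the following formulas hold. If $0<\gamma C<2$, then $$\mathrm{prox}_{\gamma C\ell_{r}}(s)=\begin{cases}\{s\},& s>1+\frac{\gamma C}{2},\\ \{s,\ s-\gamma C\},& s=1+\frac{\gamma C}{2},\\ \{s-\gamma C\},& \gamma C\le s<1+\frac{\gamma C}{2},\\ \{0\},& 0<s<\gamma C,\\ \{s\},& s\le 0,\end{cases}$$ and if $\gamma C\ge 2$, then $$\mathrm{prox}_{\gamma C\ell_{r}}(s)=\begin{cases}\{s\},& s>\sqrt{2\gamma C},\\ \{s,\ 0\},& s=\sqrt{2\gamma C},\\ \{0\},& 0<s<\sqrt{2\gamma C},\\ \{s\},& s\le 0.\end{cases}$$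
   Context: The ramp loss $\ell_r:\mathbb{R}\to\mathbb{R}$ is defined by $\ell_r(t)=1$ for $t\ge 1$, $\ell_r(t)=t$ for $0\le t<1$, and $\ell_r(t)=0$ for $t<0$. For $\mathbf{v}\in\mathbb{R}^m$, $L_r(\mathbf{v})=\sum_{i=1}^m\ell_r(v_i)$. For $\gamma,C>0$, the (set-valued) proximal operators are the sets of global minimizers $$\mathrm{prox}_{\gamma C\ell_r}(s)=\arg\min_{v\in\mathbb{R}}\ C\ell_r(v)+\frac{1}{2\gamma}(v-s)^2\quad(s\in\mathbb{R}),$$ $$\mathrm{prox}_{\gamma C L_r}(\mathbf{s})=\arg\min_{\mathbf{v}\in\mathbb{R}^m}\ C L_r(\mathbf{v})+\frac{1}{2\gamma}\|\mathbf{v}-\mathbf{s}\|^2\quad(\mathbf{s}\in\mathbb{R}^m),$$ with $\|\cdot\|$ the Euclidean norm. *)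

theory Defs
  imports "HOL-Analysis.Analysis"
begin

definition ramp_loss :: "real \<Rightarrow> real" where
  "ramp_loss t = (if t \<ge> 1 then 1 else if t \<ge> 0 then t else 0)"

definition ramp_loss_sum :: "real ^ 'm \<Rightarrow> real" where
  "ramp_loss_sum v = (\<Sum>i\<in>UNIV. ramp_loss (v $ i))"

text \<open>
  \<open>prox \<gamma> f s\<close> is the set of all global minimizers, so it may be empty or have several elements.
  On \<open>real\<close> the norm is the absolute value; on \<open>real ^ 'm\<close> it is the Euclidean norm.
\<close>

definition prox :: "real \<Rightarrow> ('a::real_normed_vector \<Rightarrow> real) \<Rightarrow> 'a \<Rightarrow> 'a set" where
  "prox \<gamma> f s =
    {v. is_arg_min (\<lambda>u. f u + 1 / (2 * \<gamma>) * (norm (u - s))\<^sup>2) (\<lambda>_. True) v}"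

end

theory Submission
  imports Defs
begin

text \<open>
  The objective of the vector problem is a sum of one-dimensional objectives in separate
  coordinates, so it is minimized coordinatewise. In one dimension, multiplying the objective by
  \<open>2 * \<gamma>\<close> and writing \<open>a = \<gamma> * C\<close> turns it into \<open>2 * a * ramp_loss u + (u - t)\<^sup>2\<close>, which is a
  parabola on each of \<open>u < 0\<close>, \<open>0 \<le> u < 1\<close> and \<open>u \<ge> 1\<close>. The competing values are \<open>t\<^sup>2\<close> at \<open>0\<close>,
  \<open>2 * a * t - a\<^sup>2\<close> at \<open>t - a\<close> and \<open>2 * a\<close> at \<open>t\<close>. The last two agree at \<open>t = 1 + a / 2\<close>, the
  first and the last at \<open>t = sqrt (2 * a)\<close>.
\<close>

lemma prox_iff:
  "v \<in> prox \<gamma> f s \<longleftrightarrow>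
     (\<forall>u. f v + 1 / (2 * \<gamma>) * (norm (v - s))\<^sup>2 \<le> f u + 1 / (2 * \<gamma>) * (norm (u - s))\<^sup>2)"
  by (auto simp: prox_def is_arg_min_def not_less)

lemma norm_vec_power2: "(norm (x :: real ^ 'm))\<^sup>2 = (\<Sum>i\<in>UNIV. (x $ i)\<^sup>2)"
  by (simp add: norm_vec_def L2_set_def sum_nonneg)

text \<open>Changing a single coordinate \<open>i\<close> of a minimizer to \<open>y\<close> leaves
  all other summands fixed, so they cancel and \<open>v $ i\<close> must minimize the summand
  \<open>g i\<close>. Conversely, coordinatewise inequalities add up.\<close>

lemma prox_separable:
  fixes f :: "'m::finite \<Rightarrow> real \<Rightarrow> real" and s :: "real ^ 'm"
  shows "prox \<gamma> (\<lambda>v. \<Sum>i\<in>UNIV. f i (v $ i)) s = {v. \<forall>i. v $ i \<in> prox \<gamma> (f i) (s $ i)}"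
proof -
  define g where "g i x = f i x + 1 / (2 * \<gamma>) * (x - s $ i)\<^sup>2" for i x
  have obj: "(\<Sum>i\<in>UNIV. f i (v $ i)) + 1 / (2 * \<gamma>) * (norm (v - s))\<^sup>2 = (\<Sum>i\<in>UNIV. g i (v $ i))"
    for v
    by (simp add: g_def norm_vec_power2 sum.distrib sum_distrib_left)
  have comp: "x \<in> prox \<gamma> (f i) (s $ i) \<longleftrightarrow> (\<forall>y. g i x \<le> g i y)" for i x
    by (simp add: prox_iff g_def)
  have "(\<forall>u. (\<Sum>i\<in>UNIV. g i (v $ i)) \<le> (\<Sum>i\<in>UNIV. g i (u $ i))) \<longleftrightarrow>
        (\<forall>i y. g i (v $ i) \<le> g i y)" for v :: "real ^ 'm"
  proof (intro iffI allI)
    fix i y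
    assume min: "\<forall>u :: real ^ 'm. (\<Sum>j\<in>UNIV. g j (v $ j)) \<le> (\<Sum>j\<in>UNIV. g j (u $ j))"
    define u :: "real ^ 'm" where "u = (\<chi> j. if j = i then y else v $ j)"
    have split: "(\<Sum>j\<in>UNIV. g j (w $ j)) = g i (w $ i) + (\<Sum>j\<in>UNIV - {i}. g j (w $ j))" for w
      by (simp add: sum.remove)
    have rest: "(\<Sum>j\<in>UNIV - {i}. g j (u $ j)) = (\<Sum>j\<in>UNIV - {i}. g j (v $ j))"
      by (intro sum.cong) (auto simp: u_def)
    have "u $ i = y" by (simp add: u_def)
    then show "g i (v $ i) \<le> g i y"
      using min[rule_format, of u] unfolding split[of u] split[of v] rest by simp
  qed (auto intro: sum_mono)
  then show ?thesis
    by (simp only: set_eq_iff mem_Collect_eq prox_iff[of _ _ _ s] obj comp) simp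
qed

context
  fixes \<gamma> C :: real
  assumes \<gamma>_pos: "\<gamma> > 0" and C_pos: "C > 0"
begin

private abbreviation obj :: "real \<Rightarrow> real \<Rightarrow> real" where
  "obj t u \<equiv> 2 * (\<gamma> * C) * ramp_loss u + (u - t)\<^sup>2"

lemma prox_ramp_iff:
  "v \<in> prox \<gamma> (\<lambda>x. C * ramp_loss x) t \<longleftrightarrow> (\<forall>u. obj t v \<le> obj t u)"
proof -
  have "C * ramp_loss u + 1 / (2 * \<gamma>) * (norm (u - t))\<^sup>2 = 1 / (2 * \<gamma>) * obj t u" for u
    using \<gamma>_pos by (simp add: field_simps)
  then show ?thesis
    using \<gamma>_pos by (simp add: prox_iff divide_le_cancel)
qed

text \<open>A point of \<open>S\<close> attains \<open>m\<close> and thereby beats everything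
  outside \<open>S\<close>. Each case of the formula thus reduces to naming the minimal value and
  separating it strictly from all other values.\<close>

lemma prox_ramp_eqI:
  assumes "S \<noteq> {}" and "\<And>u. u \<in> S \<Longrightarrow> obj t u = m" and "\<And>u. u \<notin> S \<Longrightarrow> m < obj t u"
  shows "prox \<gamma> (\<lambda>x. C * ramp_loss x) t = S"
proof -
  obtain p where "p \<in> S" using assms(1) by blast
  then have "obj t v \<le> obj t p \<longleftrightarrow> v \<in> S" "m \<le> obj t v" for v
    using assms(2,3) by (metis order.refl not_le, metis less_imp_le order.refl)
  then show ?thesis
    using assms(2) by (auto simp: set_eq_iff prox_ramp_iff)
qed

lemma obj_neg_gt:
  assumes "t > 0" "u < 0" shows "t\<^sup>2 < obj t u"
proof -
  \<comment> \<open>The product is \<open>obj t u - t\<^sup>2\<close>, since the loss vanishes at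
    negative \<open>u\<close>.\<close>
  have "0 < u * (u - 2 * t)" using assms by (intro mult_neg_neg) auto
  then show ?thesis using assms by (simp add: ramp_loss_def power2_eq_square algebra_simps)
qed

text \<open>The first form completes the square and exhibits the vertex
  \<open>t - \<gamma> * C\<close> with its value; the second is relative to the value at 0.\<close>

lemma obj_mid:
  assumes "0 \<le> u" "u < 1"
  shows "obj t u = 2 * (\<gamma> * C) * t - (\<gamma> * C)\<^sup>2 + (u - (t - \<gamma> * C))\<^sup>2"
    and "obj t u = t\<^sup>2 + u * (u + 2 * (\<gamma> * C - t))"
  using assms by (simp_all add: ramp_loss_def power2_eq_square algebra_simps)

lemma obj_ge_1:
  assumes "1 \<le> u" shows "2 * (\<gamma> * C) \<le> obj t u" and "u \<noteq> t \<Longrightarrow> 2 * (\<gamma> * C) < obj t u"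
  using assms by (simp_all add: ramp_loss_def)

lemma shift_value_le: "2 * (\<gamma> * C) * t - (\<gamma> * C)\<^sup>2 \<le> t\<^sup>2"
  using zero_le_power2[of "t - \<gamma> * C"] by (simp add: power2_diff algebra_simps)

text \<open>If \<open>t \<le> \<gamma> * C\<close>, the vertex of the middle parabola does not lie
  to the right of 0, so the objective increases strictly on the middle piece and 0 is the only
  candidate below 1.\<close>

lemma obj_less_zero_gt:
  assumes "0 < t" "t \<le> \<gamma> * C" "u < 1" "u \<noteq> 0" shows "t\<^sup>2 < obj t u"
proof (cases "u < 0")
  case False
  then have "0 < u * (u + 2 * (\<gamma> * C - t))" using assms by (intro mult_pos_pos) auto
  then show ?thesis using False assms obj_mid(2)[of u t] by simp
qed (use assms obj_neg_gt in auto)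

lemma prox_ramp_nonpos:
  assumes "t \<le> 0" shows "prox \<gamma> (\<lambda>x. C * ramp_loss x) t = {t}"
proof (rule prox_ramp_eqI[where m = 0])
  fix u assume "u \<notin> {t}"
  then have "0 < (u - t)\<^sup>2" by simp
  moreover have "0 \<le> 2 * (\<gamma> * C) * ramp_loss u"
    using \<gamma>_pos C_pos by (simp add: ramp_loss_def)
  ultimately show "0 < obj t u" by linarith
qed (use assms in \<open>auto simp: ramp_loss_def\<close>)

text \<open>The second assumption settles \<open>u < 1\<close>; the third puts
  \<open>t\<^sup>2\<close> below the bound \<open>2 * (\<gamma> * C)\<close> valid for
  \<open>u \<ge> 1\<close>. This serves both regimes of \<open>\<gamma> * C\<close>.\<close>

lemma prox_ramp_zero:
  assumes "0 < t" "t \<le> \<gamma> * C" "t\<^sup>2 < 2 * (\<gamma> * C)"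
  shows "prox \<gamma> (\<lambda>x. C * ramp_loss x) t = {0}"
proof (rule prox_ramp_eqI[where m = "t\<^sup>2"])
  fix u assume "u \<notin> {0::real}"
  then show "t\<^sup>2 < obj t u"
    using assms obj_less_zero_gt[of t u] obj_ge_1(1)[of u t]
    by (cases "u < 1") (blast, linarith)
qed (auto simp: ramp_loss_def)

lemma prox_ramp_shift:
  assumes "\<gamma> * C < 2" "\<gamma> * C \<le> t" "t < 1 + \<gamma> * C / 2"
  shows "prox \<gamma> (\<lambda>x. C * ramp_loss x) t = {t - \<gamma> * C}"
proof (rule prox_ramp_eqI[where m = "2 * (\<gamma> * C) * t - (\<gamma> * C)\<^sup>2"])
  have a: "0 < \<gamma> * C" using \<gamma>_pos C_pos by simp
  fix u assume u: "u \<notin> {t - \<gamma> * C}"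
  consider "u < 0" | "0 \<le> u" "u < 1" | "1 \<le> u" by linarith
  then show "2 * (\<gamma> * C) * t - (\<gamma> * C)\<^sup>2 < obj t u"
  proof cases
    case 1
    then show ?thesis
      using obj_neg_gt[of t u] shift_value_le[of t] a assms by linarith
  next
    case 2
    then show ?thesis using obj_mid(1)[of u t] u by simp
  next
    case 3
    \<comment> \<open>Scaled by 2, this says that the vertex value lies below the value on the flat
      branch.\<close>
    have "(\<gamma> * C) * t < (\<gamma> * C) * (1 + \<gamma> * C / 2)"
      using a assms by (intro mult_strict_left_mono)
    then have "2 * (\<gamma> * C) * t - (\<gamma> * C)\<^sup>2 < 2 * (\<gamma> * C)"
      by (simp add: power2_eq_square algebra_simps)
    then show ?thesis using obj_ge_1(1)[OF 3, of t] by linarith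
  qed
next
  have "0 < \<gamma> * C" using \<gamma>_pos C_pos by simp
  then have "t - \<gamma> * C < 1" using assms by linarith
  moreover fix u assume "u \<in> {t - \<gamma> * C}"
  ultimately show "obj t u = 2 * (\<gamma> * C) * t - (\<gamma> * C)\<^sup>2"
    using obj_mid(1)[of "t - \<gamma> * C" t] assms by simp
qed simp

lemma prox_ramp_tie_shift:
  assumes "\<gamma> * C < 2" "t = 1 + \<gamma> * C / 2"
  shows "prox \<gamma> (\<lambda>x. C * ramp_loss x) t = {t, t - \<gamma> * C}"
proof (rule prox_ramp_eqI[where m = "2 * (\<gamma> * C)"])
  have a: "0 < \<gamma> * C" using \<gamma>_pos C_pos by simp
  have tie: "2 * (\<gamma> * C) * t - (\<gamma> * C)\<^sup>2 = 2 * (\<gamma> * C)"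
    using assms by (simp add: power2_eq_square algebra_simps)
  {
    fix u assume u: "u \<notin> {t, t - \<gamma> * C}"
    consider "u < 0" | "0 \<le> u" "u < 1" | "1 \<le> u" by linarith
    then show "2 * (\<gamma> * C) < obj t u"
    proof cases
      case 1
      then show ?thesis
        using obj_neg_gt[of t u] shift_value_le[of t] a assms(2) tie by linarith
    qed (use obj_mid(1)[of u t] obj_ge_1(2)[of u t] u tie in auto)
  next
    \<comment> \<open>Here \<open>t - \<gamma> * C = 1 - \<gamma> * C / 2\<close>, which
      \<open>\<gamma> * C < 2\<close> keeps positive.\<close>
    have "0 \<le> t - \<gamma> * C" "t - \<gamma> * C < 1" using a assms by linarith+
    then have "obj t (t - \<gamma> * C) = 2 * (\<gamma> * C)"
      using obj_mid(1)[of "t - \<gamma> * C" t] tie by simp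
    moreover have "obj t t = 2 * (\<gamma> * C)"
      using assms a by (simp add: ramp_loss_def)
    moreover fix u assume "u \<in> {t, t - \<gamma> * C}"
    ultimately show "obj t u = 2 * (\<gamma> * C)" by blast
  }
qed simp

text \<open>The disjunction offers two ways to exclude \<open>0 < u < 1\<close>: either the
  objective there exceeds \<open>t\<^sup>2\<close>, or already the vertex value exceeds
  \<open>2 * (\<gamma> * C)\<close>. The bound on \<open>t\<^sup>2\<close> excludes 0 and negative
  \<open>u\<close>.\<close>

lemma prox_ramp_self:
  assumes "1 \<le> t" "2 * (\<gamma> * C) < t\<^sup>2" "t \<le> \<gamma> * C \<or> 1 + \<gamma> * C / 2 < t"
  shows "prox \<gamma> (\<lambda>x. C * ramp_loss x) t = {t}"
proof (rule prox_ramp_eqI[where m = "2 * (\<gamma> * C)"])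
  have a: "0 < \<gamma> * C" using \<gamma>_pos C_pos by simp
  fix u assume u: "u \<notin> {t}"
  consider "u < 0" | "u = 0" | "0 < u" "u < 1" | "1 \<le> u" by linarith
  then show "2 * (\<gamma> * C) < obj t u"
  proof cases
    case 3
    show ?thesis
    proof (cases "t \<le> \<gamma> * C")
      case True
      then show ?thesis using obj_less_zero_gt[of t u] 3 assms by simp
    next
      case False
      then have "(\<gamma> * C) * (1 + \<gamma> * C / 2) < (\<gamma> * C) * t"
        using a assms by (intro mult_strict_left_mono) auto
      then have "2 * (\<gamma> * C) < 2 * (\<gamma> * C) * t - (\<gamma> * C)\<^sup>2"
        by (simp add: power2_eq_square algebra_simps)
      then show ?thesis using obj_mid(1)[of u t] 3 by (smt (verit) zero_le_power2)
    qed
  qed (use obj_neg_gt[of t u] obj_ge_1(2)[of u t] u assms in \<open>auto simp: ramp_loss_def\<close>)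
qed (use assms in \<open>auto simp: ramp_loss_def\<close>)

lemma prox_ramp_tie_zero:
  assumes "1 \<le> t" "t\<^sup>2 = 2 * (\<gamma> * C)" "t \<le> \<gamma> * C"
  shows "prox \<gamma> (\<lambda>x. C * ramp_loss x) t = {t, 0}"
proof (rule prox_ramp_eqI[where m = "t\<^sup>2"])
  fix u assume "u \<notin> {t, 0}"
  then show "t\<^sup>2 < obj t u"
    using assms obj_less_zero_gt[of t u] obj_ge_1(2)[of u t]
    by (cases "u < 1") auto
qed (use assms in \<open>auto simp: ramp_loss_def\<close>)

end

theorem proposition3:
  fixes \<gamma> C :: real and s :: "real ^ 'm"
  assumes "\<gamma> > 0" and "C > 0"
  shows
    "prox \<gamma> (\<lambda>v. C * ramp_loss_sum v) s =
       {v. \<forall>i. v $ i \<in> prox \<gamma> (\<lambda>x. C * ramp_loss x) (s $ i)}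
     \<and> (\<gamma> * C < 2 \<longrightarrow>
         (\<forall>t::real.
            (t > 1 + \<gamma> * C / 2 \<longrightarrow> prox \<gamma> (\<lambda>x. C * ramp_loss x) t = {t})
          \<and> (t = 1 + \<gamma> * C / 2 \<longrightarrow> prox \<gamma> (\<lambda>x. C * ramp_loss x) t = {t, t - \<gamma> * C})
          \<and> (\<gamma> * C \<le> t \<and> t < 1 + \<gamma> * C / 2 \<longrightarrow>
               prox \<gamma> (\<lambda>x. C * ramp_loss x) t = {t - \<gamma> * C})
          \<and> (0 < t \<and> t < \<gamma> * C \<longrightarrow> prox \<gamma> (\<lambda>x. C * ramp_loss x) t = {0})
          \<and> (t \<le> 0 \<longrightarrow> prox \<gamma> (\<lambda>x. C * ramp_loss x) t = {t})))
     \<and> (\<gamma> * C \<ge> 2 \<longrightarrow>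
         (\<forall>t::real.
            (t > sqrt (2 * \<gamma> * C) \<longrightarrow> prox \<gamma> (\<lambda>x. C * ramp_loss x) t = {t})
          \<and> (t = sqrt (2 * \<gamma> * C) \<longrightarrow> prox \<gamma> (\<lambda>x. C * ramp_loss x) t = {t, 0})
          \<and> (0 < t \<and> t < sqrt (2 * \<gamma> * C) \<longrightarrow> prox \<gamma> (\<lambda>x. C * ramp_loss x) t = {0})
          \<and> (t \<le> 0 \<longrightarrow> prox \<gamma> (\<lambda>x. C * ramp_loss x) t = {t})))"
proof -
  let ?a = "\<gamma> * C"
  have a: "0 < ?a" using assms by simp
  have "(\<lambda>v. C * ramp_loss_sum v) = (\<lambda>v :: real ^ 'm. \<Sum>i\<in>UNIV. C * ramp_loss (v $ i))"
    by (simp add: ramp_loss_sum_def sum_distrib_left)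
  then have sep: "prox \<gamma> (\<lambda>v. C * ramp_loss_sum v) s =
      {v. \<forall>i. v $ i \<in> prox \<gamma> (\<lambda>x. C * ramp_loss x) (s $ i)}"
    using prox_separable[of \<gamma> "\<lambda>_ x. C * ramp_loss x" s] by simp
  have self: "prox \<gamma> (\<lambda>x. C * ramp_loss x) t = {t}" if "1 + ?a / 2 < t" for t
  proof (rule prox_ramp_self[OF assms])
    \<comment> \<open>The inequality of arithmetic and geometric means: the squares of
      \<open>1 + ?a / 2\<close> and \<open>1 - ?a / 2\<close> differ by
      \<open>2 * ?a\<close>.\<close>
    have "0 \<le> (1 - ?a / 2)\<^sup>2" by simp
    then have "2 * ?a \<le> (1 + ?a / 2)\<^sup>2" by (simp add: power2_eq_square algebra_simps)
    also have "\<dots> < t\<^sup>2" using a that by (intro power_strict_mono) auto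
    finally show "2 * ?a < t\<^sup>2" .
  qed (use a that in auto)
  have zero: "prox \<gamma> (\<lambda>x. C * ramp_loss x) t = {0}" if "?a < 2" "0 < t" "t < ?a" for t
  proof (rule prox_ramp_zero[OF assms])
    have "t * t < ?a * 2" using a that by (intro mult_strict_mono) auto
    then show "t\<^sup>2 < 2 * ?a" by (simp add: power2_eq_square)
  qed (use that in auto)
  define r where "r = sqrt (2 * \<gamma> * C)"
  have r: "0 < r" "r\<^sup>2 = 2 * ?a" using a by (simp_all add: r_def mult.assoc)
  \<comment> \<open>The lower bound puts \<open>r\<close> on the flat branch of the loss; the upper
    one ensures that for \<open>t \<le> r\<close> the middle piece offers no candidate but
    0.\<close>
  have r_le: "2 \<le> r" "r \<le> ?a" if "2 \<le> ?a"
  proof -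
    have "2\<^sup>2 \<le> r\<^sup>2" unfolding r(2) using that by (simp add: mult.commute)
    then show "2 \<le> r" by (rule power2_le_imp_le) (use r(1) in simp)
    have "2 * ?a \<le> ?a * ?a" using a that by (intro mult_right_mono) auto
    then have "r\<^sup>2 \<le> ?a\<^sup>2" unfolding r(2) power2_eq_square[of ?a] .
    then show "r \<le> ?a" by (rule power2_le_imp_le) (use a in simp)
  qed
  \<comment> \<open>The disjunction required by \<open>prox_ramp_self\<close> holds because
    \<open>2 \<le> ?a\<close> gives \<open>1 + ?a / 2 \<le> ?a\<close>, so any \<open>t\<close>
    above \<open>?a\<close> also exceeds \<open>1 + ?a / 2\<close>.\<close>
  have big: "prox \<gamma> (\<lambda>x. C * ramp_loss x) t = {t}" if "2 \<le> ?a" "r < t" for t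
  proof (rule prox_ramp_self[OF assms])
    have "r\<^sup>2 < t\<^sup>2" using r(1) that by (intro power_strict_mono) auto
    then show "2 * ?a < t\<^sup>2" unfolding r(2) .
  qed (use r_le that in auto)
  have small: "prox \<gamma> (\<lambda>x. C * ramp_loss x) t = {0}" if "2 \<le> ?a" "0 < t" "t < r" for t
  proof (rule prox_ramp_zero[OF assms])
    have "t\<^sup>2 < r\<^sup>2" using that by (intro power_strict_mono) auto
    then show "t\<^sup>2 < 2 * ?a" unfolding r(2) .
  qed (use r_le that in auto)
  have tie: "prox \<gamma> (\<lambda>x. C * ramp_loss x) r = {r, 0}" if "2 \<le> ?a"
    using r r_le that by (intro prox_ramp_tie_zero[OF assms]) auto
  show ?thesis
    unfolding r_def[symmetric]
    by (intro conjI impI allI)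
      (simp_all only: sep self zero big small tie prox_ramp_nonpos[OF assms]
        prox_ramp_shift[OF assms] prox_ramp_tie_shift[OF assms])
qed

end
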